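(* Let $A, B, X$ be $n\times n$ complex matrices such that $A$ and $B$ are positive semidefinite, and let $r=\min\{\nu,1-\nu\}$, $R=\max\{\nu,1-\nu\}$, $r_0=\min\{2r,1-2r\}$. (i) If $0<\nu\leq\frac12$, then $$r^{2}\|AX+XB\|_2^2-\left(4\left(r^{2}\|A^{\frac12}XB^{\frac12}\|_2^2+r_0\|A^{\frac34}XB^{\frac14}\|_2^2\right)-r_0\|A^{\frac12}XB^{\frac12}+AX\|_2^2\right)$$ $$\leq\|(1-\nu)AX+\nu XB\|_2^2-\|A^{1-\nu}XB^{\nu}\|_2^2$$ $$\leq R^{2}\|AX+XB\|_2^2-\left(4\left(R^{2}\|A^{\frac12}XB^{\frac12}\|_2^2+r_0\|A^{\frac14}XB^{\frac34}\|_2^2\right)-r_0\|A^{\frac12}XB^{\frac12}+XB\|_2^2\right).$$ (ii) If $\frac12<\nu<1$, then $$r^{2}\|AX+XB\|_2^2-\left(4\left(r^{2}\|A^{\frac12}XB^{\frac12}\|_2^2+r_0\|A^{\frac14}XB^{\frac34}\|_2^2\right)-r_0\|A^{\frac12}XB^{\frac12}+XB\|_2^2\right)$$ $$\leq\|(1-\nu)AX+\nu XB\|_2^2-\|A^{1-\nu}XB^{\nu}\|_2^2$$ $$\leq R^{2}\|AX+XB\|_2^2-\left(4\left(R^{2}\|A^{\frac12}XB^{\frac12}\|_2^2+r_0\|A^{\frac34}XB^{\frac14}\|_2^2\right)-r_0\|A^{\frac12}XB^{\frac12}+AX\|_2^2\right).$$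
   Context: $\|\cdot\|_2$ is the Hilbert-Schmidt norm: $\|T\|_2=\left(\sum_{i,j=1}^n|t_{ij}|^2\right)^{1/2}$ for $T=[t_{ij}]$. Real powers of positive semidefinite matrices are defined by the spectral functional calculus. *)

theory Defs
  imports "Jordan_Normal_Form.Schur_Decomposition"
begin

definition hermitian_mat :: "nat \<Rightarrow> complex mat \<Rightarrow> bool" where
  "hermitian_mat n A \<longleftrightarrow> A \<in> carrier_mat n n \<and> mat_adjoint A = A"

definition psd_mat :: "nat \<Rightarrow> complex mat \<Rightarrow> bool" where
  "psd_mat n A \<longleftrightarrow> hermitian_mat n A \<and>
     (\<forall>v \<in> carrier_vec n. 0 \<le> Re ((A *\<^sub>v v) \<bullet>c v))"

definition unitary_mat :: "nat \<Rightarrow> complex mat \<Rightarrow> bool" where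
  "unitary_mat n U \<longleftrightarrow> U \<in> carrier_mat n n \<and>
     mat_adjoint U * U = 1\<^sub>m n \<and> U * mat_adjoint U = 1\<^sub>m n"

definition hs_norm :: "complex mat \<Rightarrow> real" where
  "hs_norm T = sqrt (\<Sum>i<dim_row T. \<Sum>j<dim_col T. (cmod (T $$ (i, j)))\<^sup>2)"

definition real_diag :: "nat \<Rightarrow> (nat \<Rightarrow> real) \<Rightarrow> complex mat" where
  "real_diag n d = mat_diag n (\<lambda>i. complex_of_real (d i))"

definition spectral_decomposition ::
  "nat \<Rightarrow> complex mat \<Rightarrow> complex mat \<Rightarrow> (nat \<Rightarrow> real) \<Rightarrow> bool" where
  "spectral_decomposition n A U d \<longleftrightarrow>
     unitary_mat n U \<and> A = U * real_diag n d * mat_adjoint U"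

text \<open>Spectral functional calculus of a Hermitian matrix \<open>A\<close>: if \<open>A = U diag(d) U\<^sup>*\<close> with
  \<open>U\<close> unitary, then \<open>f(A) = U diag(f(d)) U\<^sup>*\<close>. The result does not depend on the chosen
  decomposition (\<open>spectral_fun_unique\<close> below).\<close>

definition spectral_fun :: "(real \<Rightarrow> real) \<Rightarrow> complex mat \<Rightarrow> complex mat" where
  "spectral_fun f A = (THE F. \<exists>U d. spectral_decomposition (dim_row A) A U d \<and>
     F = U * real_diag (dim_row A) (f \<circ> d) * mat_adjoint U)"

text \<open>For \<open>p > 0\<close>, \<open>0 powr p = 0\<close>, so this is the usual power of a positive semidefinite
  matrix, singular ones included. For \<open>p = 0\<close> it is the projection onto the range, because
  \<open>0 powr 0 = 0\<close>.\<close>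

definition mat_powr :: "complex mat \<Rightarrow> real \<Rightarrow> complex mat" (infixr \<open>powr\<^sub>m\<close> 80) where
  "A powr\<^sub>m p = spectral_fun (\<lambda>x. x powr p) A"

lemma mat_adjoint_carrier: "A \<in> carrier_mat n m \<Longrightarrow> mat_adjoint A \<in> carrier_mat m n"
  by (auto simp: mat_adjoint_def)

lemma real_diag_carrier: "real_diag n d \<in> carrier_mat n n"
  by (simp add: real_diag_def)

lemma spectral_fun_unique:
  assumes U: "spectral_decomposition n A U d" and V: "spectral_decomposition n A V e"
  shows "U * real_diag n (f \<circ> d) * mat_adjoint U = V * real_diag n (f \<circ> e) * mat_adjoint V"
proof -
  let ?U = "mat_adjoint U" and ?V = "mat_adjoint V"
  have c: "U \<in> carrier_mat n n" "V \<in> carrier_mat n n"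
    and UU: "?U * U = 1\<^sub>m n" "U * ?U = 1\<^sub>m n" and VV: "?V * V = 1\<^sub>m n" "V * ?V = 1\<^sub>m n"
    using U V by (auto simp: spectral_decomposition_def unitary_mat_def)
  have c': "?U \<in> carrier_mat n n" "?V \<in> carrier_mat n n"
    using c by (auto intro: mat_adjoint_carrier)
  note rc = real_diag_carrier
  define W where "W = ?V * U"
  have W: "W \<in> carrier_mat n n" using c c' by (simp add: W_def)
  have eq: "U * real_diag n d * ?U = V * real_diag n e * ?V"
    using U V by (simp add: spectral_decomposition_def)
  have canc: "?U * (U * M) = M" "?V * (V * M) = M" "U * (?U * M) = M" "V * (?V * M) = M"
    if "M \<in> carrier_mat n n" for M
    using c c' UU VV that by (simp_all flip: assoc_mult_mat)
  note assoc = assoc_mult_mat[where n\<^sub>1=n and n\<^sub>2=n and n\<^sub>3=n and n\<^sub>4=n]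
  have intertw: "W * real_diag n d = real_diag n e * W"
  proof -
    have "W * real_diag n d = ?V * (U * real_diag n d * ?U) * U"
      using c c' rc UU by (simp add: W_def assoc canc mult_carrier_mat[where n=n]
          right_mult_one_mat[OF rc])
    also have "\<dots> = real_diag n e * W"
      unfolding eq using c c' rc by (simp add: W_def assoc canc mult_carrier_mat[where n=n])
    finally show ?thesis .
  qed
  have entry: "(W * real_diag n g) $$ (i, j) = W $$ (i, j) * g j"
    "(real_diag n g * W) $$ (i, j) = g i * W $$ (i, j)" if "i < n" "j < n" for i j g
    using that W
    by (simp_all add: real_diag_def mat_diag_mult_left[OF W] mat_diag_mult_right[OF W])
  have "W * real_diag n (f \<circ> d) = real_diag n (f \<circ> e) * W"
  proof (rule eq_matI)
    fix i j assume "i < dim_row (real_diag n (f \<circ> e) * W)" "j < dim_col (real_diag n (f \<circ> e) * W)"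
    hence ij: "i < n" "j < n" using W by (auto simp: real_diag_def mat_diag_def)
    have "W $$ (i, j) * d j = e i * W $$ (i, j)"
      using entry[OF ij] intertw by metis
    hence "W $$ (i, j) = 0 \<or> d j = e i" by (auto simp: mult.commute)
    thus "(W * real_diag n (f \<circ> d)) $$ (i, j) = (real_diag n (f \<circ> e) * W) $$ (i, j)"
      by (auto simp: entry[OF ij])
  qed (use W in \<open>auto simp: real_diag_def mat_diag_def\<close>)
  hence "V * (W * real_diag n (f \<circ> d)) * ?U = V * (real_diag n (f \<circ> e) * W) * ?U"
    by simp
  thus ?thesis
    using c c' rc UU
    by (simp add: W_def assoc canc mult_carrier_mat[where n=n] right_mult_one_mat[OF c'(2)])
qed

lemma spectral_fun_eq:
  assumes "spectral_decomposition n A U d"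
  shows "spectral_fun f A = U * real_diag n (f \<circ> d) * mat_adjoint U"
proof -
  have n: "dim_row A = n"
    using assms by (auto simp: spectral_decomposition_def unitary_mat_def)
  show ?thesis
    unfolding spectral_fun_def n
    using assms spectral_fun_unique by (intro the_equality) blast+
qed

end

theory Submission
  imports Defs "HOL-Analysis.Convex"
begin

text \<open>
  Left multiplication by \<open>A\<close> and right multiplication by \<open>B\<close> are commuting positive operators
  on the space of \<open>n \<times> n\<close> matrices with the Hilbert--Schmidt inner product. Diagonalise
  \<open>A = U diag(d) U\<^sup>*\<close> and \<open>B = V diag(e) V\<^sup>*\<close> and put \<open>Y = U\<^sup>* X V\<close>. Every matrix in the claim is
  then \<open>U (g(d\<^sub>i, e\<^sub>j) y\<^sub>i\<^sub>j) V\<^sup>*\<close> for an explicit real function \<open>g\<close>: for instance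
  \<open>g(a, b) = a\<^sup>p b\<^sup>q\<close> for \<open>A\<^sup>p X B\<^sup>q\<close> (lemma \<open>joint_fun_product\<close>). By unitary invariance its squared
  norm is the sum of \<open>g(d\<^sub>i, e\<^sub>j)\<^sup>2 |y\<^sub>i\<^sub>j|\<^sup>2\<close> (lemma \<open>hs_norm_joint_fun\<close>). As \<open>d\<^sub>i, e\<^sub>j \<ge> 0\<close>, it is
  enough to prove each inequality for two nonnegative numbers \<open>a, b\<close> in place of \<open>A, B\<close>, with \<open>X = 1\<close>.

  For numbers and \<open>\<nu> \<le> 1/2\<close>, completing squares turns the lower bound into
  \<open>\<nu>\<^sup>2 (a - b)\<^sup>2 + r\<^sub>0 a (\<surd>a - \<surd>b)\<^sup>2\<close>. Since
  \<open>((1 - \<nu>) a + \<nu> b)\<^sup>2 - \<nu>\<^sup>2 (a - b)\<^sup>2 = a ((1 - 2\<nu>) a + 2\<nu> b)\<close>, the claim is \<open>a\<close> times Young's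
  inequality with weight \<open>2\<nu>\<close>, refined by the remainder \<open>r\<^sub>0 (\<surd>a - \<surd>b)\<^sup>2\<close>
  (lemma \<open>refined_young\<close>). In the same way the upper bound becomes
  \<open>(1 - \<nu>)\<^sup>2 (a - b)\<^sup>2 + r\<^sub>0 b (\<surd>a - \<surd>b)\<^sup>2\<close>, and after subtracting the first term and dividing by
  \<open>b > 0\<close> what remains is Young's inequality with weight \<open>2 - 2\<nu> \<ge> 1\<close>, for which the inequality sign is
  reversed (lemma \<open>reverse_young\<close>); the term with \<open>r\<^sub>0\<close> only adds something nonnegative. The case
  \<open>\<nu> > 1/2\<close> is the case \<open>1 - \<nu>\<close> with \<open>a\<close> and \<open>b\<close> exchanged.

  The diagonalisation is obtained by induction on the dimension: a unit eigenvector is completed to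
  an orthonormal basis, and in this basis the Hermitian matrix splits off a real \<open>1 \<times> 1\<close> block.
\<close>

section \<open>Scalar inequalities\<close>

text \<open>The remainder is exactly absorbed by the arithmetic mean:
  \<open>(1 - s) a + s b - s (\<surd>a - \<surd>b)\<^sup>2 = (1 - 2s) a + 2s \<surd>(a b)\<close>. Young's inequality for the
  numbers \<open>a\<close> and \<open>\<surd>(a b)\<close> bounds this below by \<open>a\<^bsup>1-2s\<^esup> (a b)\<^sup>s\<close>.\<close>
lemma refined_young_left:
  fixes a b s :: real
  assumes "0 \<le> a" "0 \<le> b" "0 \<le> s" "s \<le> 1/2"
  shows "a powr (1 - s) * b powr s + s * (sqrt a - sqrt b)\<^sup>2 \<le> (1 - s) * a + s * b"
proof (cases "a = 0 \<or> b = 0")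
  case True
  have "s * a \<le> (1 - s) * a"
    using assms by (intro mult_right_mono) auto
  then show ?thesis
    using True assms by (auto simp: power2_eq_square)
next
  case False
  with assms have pos: "0 < a" "0 < b" by auto
  have "sqrt (a * b) powr (2 * s) = a powr s * b powr s"
    using pos by (simp add: powr_half_sqrt [symmetric] powr_powr powr_mult)
  then have "a powr (1 - 2 * s) * sqrt (a * b) powr (2 * s) = a powr (1 - 2 * s + s) * b powr s"
    by (simp only: powr_add)
  then have "a powr (1 - s) * b powr s = a powr (1 - 2 * s) * sqrt (a * b) powr (2 * s)"
    by simp
  also have "\<dots> \<le> (1 - 2 * s) * a + 2 * s * sqrt (a * b)"
    using assms pos by (intro Youngs_inequality_0) auto
  finally show ?thesis
    using assms by (simp add: power2_diff real_sqrt_mult algebra_simps)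
qed

lemma refined_young:
  fixes a b s :: real
  assumes "0 \<le> a" "0 \<le> b" "0 \<le> s" "s \<le> 1"
  shows "a powr (1 - s) * b powr s + min s (1 - s) * (sqrt a - sqrt b)\<^sup>2 \<le> (1 - s) * a + s * b"
proof (cases "s \<le> 1/2")
  case True
  then show ?thesis using refined_young_left[of a b s] assms by (simp add: min_def)
next
  case False
  then have "b powr s * a powr (1 - s) + (1 - s) * (sqrt b - sqrt a)\<^sup>2 \<le> s * b + (1 - s) * a"
    using refined_young_left[of b a "1 - s"] assms by simp
  then show ?thesis
    using False by (simp add: min_def power2_commute mult.commute add.commute)
qed

text \<open>Extrapolation instead of interpolation: \<open>a\<close> is the weighted geometric mean, with weights
  \<open>1/s\<close> and \<open>1 - 1/s\<close>, of \<open>a\<^sup>s b\<^bsup>1-s\<^esup>\<close> and \<open>b\<close>. Young's inequality for these two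
  numbers, multiplied by \<open>s\<close>, is the claim.\<close>
lemma reverse_young:
  fixes a b s :: real
  assumes "0 \<le> a" "0 < b" "1 \<le> s"
  shows "s * a + (1 - s) * b \<le> a powr s * b powr (1 - s)"
proof (cases "a = 0")
  case True
  then show ?thesis using assms by (simp add: mult_nonpos_nonneg)
next
  case False
  with assms have a: "0 < a" by simp
  have s: "s \<noteq> 0" using assms by auto
  have "(a powr s * b powr (1 - s)) powr (1 / s) * b powr (1 - 1 / s)
      = a * b powr ((1 - s) / s + (1 - 1 / s))"
    using s a assms by (simp only: powr_add) (simp add: powr_mult powr_powr)
  also have "(1 - s) / s + (1 - 1 / s) = 0"
    using s by (simp add: field_simps)
  finally have "a = (a powr s * b powr (1 - s)) powr (1 / s) * b powr (1 - 1 / s)"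
    using assms by simp
  also have "\<dots> \<le> 1 / s * (a powr s * b powr (1 - s)) + (1 - 1 / s) * b"
    using assms a by (intro Youngs_inequality_0) auto
  finally have "s * a \<le> s * (1 / s * (a powr s * b powr (1 - s)) + (1 - 1 / s) * b)"
    using assms by (intro mult_left_mono) auto
  then show ?thesis
    using s by (simp add: algebra_simps)
qed

lemma powr_products_squared:
  fixes a b :: real
  assumes "0 \<le> a" "0 \<le> b"
  shows "(a powr (1/2) * b powr (1/2))\<^sup>2 = a * b"
    and "(a powr (3/4) * b powr (1/4))\<^sup>2 = a * (a powr (1/2) * b powr (1/2))"
    and "(a powr (1/4) * b powr (3/4))\<^sup>2 = b * (a powr (1/2) * b powr (1/2))"
proof -
  have sq: "(x powr p)\<^sup>2 = x powr (2 * p)" if "0 \<le> x" for x p :: real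
    by (simp add: power2_eq_square flip: powr_add)
  have th: "x powr (3/2) = x * x powr (1/2)" if "0 \<le> x" for x :: real
    using that powr_add[of x 1 "1/2"] by simp
  show "(a powr (1/2) * b powr (1/2))\<^sup>2 = a * b"
    and "(a powr (3/4) * b powr (1/4))\<^sup>2 = a * (a powr (1/2) * b powr (1/2))"
    and "(a powr (1/4) * b powr (3/4))\<^sup>2 = b * (a powr (1/2) * b powr (1/2))"
    using assms by (simp_all add: power_mult_distrib sq th)
qed

text \<open>Both \<open>((1 - \<nu>) a + \<nu> b)\<^sup>2 - \<nu>\<^sup>2 (a - b)\<^sup>2\<close> and the remaining terms are divisible by \<open>a\<close>; the quotient
  is the refined Young inequality with weight \<open>2\<nu>\<close>.\<close>
lemma scalar_lower_bound:
  fixes a b \<nu> :: real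
  assumes "0 \<le> a" "0 \<le> b" "0 \<le> \<nu>" "\<nu> \<le> 1/2" and r0: "r\<^sub>0 = min (2 * \<nu>) (1 - 2 * \<nu>)"
  shows "\<nu>\<^sup>2 * (a + b)\<^sup>2
      - (4 * (\<nu>\<^sup>2 * (a powr (1/2) * b powr (1/2))\<^sup>2 + r\<^sub>0 * (a powr (3/4) * b powr (1/4))\<^sup>2)
         - r\<^sub>0 * (a powr (1/2) * b powr (1/2) + a)\<^sup>2)
    \<le> ((1 - \<nu>) * a + \<nu> * b)\<^sup>2 - (a powr (1 - \<nu>) * b powr \<nu>)\<^sup>2"
proof -
  define x y where "x = sqrt a" and "y = sqrt b"
  have xy: "a = x\<^sup>2" "b = y\<^sup>2" using assms by (simp_all add: x_def y_def)
  have half: "a powr (1/2) = x" "b powr (1/2) = y"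
    using assms by (simp_all add: x_def y_def powr_half_sqrt)
  have "(a powr (1 - \<nu>) * b powr \<nu>)\<^sup>2 = a powr (1 + (1 - 2 * \<nu>)) * b powr (2 * \<nu>)"
    by (simp add: power2_eq_square mult_ac flip: powr_add)
  also have "\<dots> = a * (a powr (1 - 2 * \<nu>) * b powr (2 * \<nu>))"
    using assms by (simp only: powr_add) simp
  finally have pw: "(a powr (1 - \<nu>) * b powr \<nu>)\<^sup>2 = a * (a powr (1 - 2 * \<nu>) * b powr (2 * \<nu>))" .
  have "a powr (1 - 2 * \<nu>) * b powr (2 * \<nu>) + r\<^sub>0 * (x - y)\<^sup>2 \<le> (1 - 2 * \<nu>) * a + 2 * \<nu> * b"
    using refined_young[of a b "2 * \<nu>"] assms unfolding r0 x_def y_def by simp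
  then have "a * (a powr (1 - 2 * \<nu>) * b powr (2 * \<nu>) + r\<^sub>0 * (x - y)\<^sup>2)
      \<le> a * ((1 - 2 * \<nu>) * a + 2 * \<nu> * b)"
    using assms by (intro mult_left_mono)
  then have "a * (a powr (1 - 2 * \<nu>) * b powr (2 * \<nu>)) + a * (r\<^sub>0 * (x - y)\<^sup>2)
      \<le> a * ((1 - 2 * \<nu>) * a + 2 * \<nu> * b)"
    by (simp only: distrib_left)
  moreover have "\<nu>\<^sup>2 * (a + b)\<^sup>2 - (4 * (\<nu>\<^sup>2 * (a * b) + r\<^sub>0 * (a * (x * y))) - r\<^sub>0 * (x * y + a)\<^sup>2)
      = ((1 - \<nu>) * a + \<nu> * b)\<^sup>2 - a * ((1 - 2 * \<nu>) * a + 2 * \<nu> * b) + a * (r\<^sub>0 * (x - y)\<^sup>2)"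
    unfolding xy by (simp add: power2_eq_square algebra_simps)
  ultimately show ?thesis
    unfolding powr_products_squared[OF assms(1,2)] pw unfolding half by linarith
qed

text \<open>Both \<open>((1 - \<nu>) a + \<nu> b)\<^sup>2 - (1 - \<nu>)\<^sup>2 (a - b)\<^sup>2\<close> and the remaining terms are divisible by \<open>b\<close>.
  For \<open>b > 0\<close> the quotient is the reversed Young inequality with weight \<open>2 - 2\<nu>\<close>, up to the nonnegative term
  \<open>r\<^sub>0 (\<surd>a - \<surd>b)\<^sup>2\<close>; for \<open>b = 0\<close> only \<open>(1 - \<nu>)\<^sup>2 a\<^sup>2\<close> is left on both sides.\<close>
lemma scalar_upper_bound:
  fixes a b \<nu> :: real
  assumes "0 \<le> a" "0 \<le> b" "\<nu> \<le> 1/2" and r0: "0 \<le> r\<^sub>0"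
  shows "((1 - \<nu>) * a + \<nu> * b)\<^sup>2 - (a powr (1 - \<nu>) * b powr \<nu>)\<^sup>2
    \<le> (1 - \<nu>)\<^sup>2 * (a + b)\<^sup>2
      - (4 * ((1 - \<nu>)\<^sup>2 * (a powr (1/2) * b powr (1/2))\<^sup>2 + r\<^sub>0 * (a powr (1/4) * b powr (3/4))\<^sup>2)
         - r\<^sub>0 * (a powr (1/2) * b powr (1/2) + b)\<^sup>2)"
proof -
  define x y where "x = sqrt a" and "y = sqrt b"
  have xy: "a = x\<^sup>2" "b = y\<^sup>2" using assms by (simp_all add: x_def y_def)
  have half: "a powr (1/2) = x" "b powr (1/2) = y"
    using assms by (simp_all add: x_def y_def powr_half_sqrt)
  have key: "b * ((2 - 2 * \<nu>) * a + (1 - (2 - 2 * \<nu>)) * b) \<le> (a powr (1 - \<nu>) * b powr \<nu>)\<^sup>2"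
  proof (cases "b = 0")
    case False
    then have b: "0 < b" using assms by simp
    have "(a powr (1 - \<nu>) * b powr \<nu>)\<^sup>2 = a powr (2 - 2 * \<nu>) * b powr (1 + (1 - (2 - 2 * \<nu>)))"
      by (simp add: power2_eq_square mult_ac flip: powr_add)
    also have "\<dots> = b * (a powr (2 - 2 * \<nu>) * b powr (1 - (2 - 2 * \<nu>)))"
      using b by (simp only: powr_add) simp
    finally show ?thesis
      using reverse_young[of a b "2 - 2 * \<nu>"] assms b by simp
  qed simp
  have "0 \<le> b * (r\<^sub>0 * (x - y)\<^sup>2)" using assms by simp
  moreover have "(1 - \<nu>)\<^sup>2 * (a + b)\<^sup>2
        - (4 * ((1 - \<nu>)\<^sup>2 * (a * b) + r\<^sub>0 * (b * (x * y))) - r\<^sub>0 * (x * y + b)\<^sup>2)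
      = ((1 - \<nu>) * a + \<nu> * b)\<^sup>2 - b * ((2 - 2 * \<nu>) * a + (1 - (2 - 2 * \<nu>)) * b)
        + b * (r\<^sub>0 * (x - y)\<^sup>2)"
    unfolding xy by (simp add: power2_eq_square algebra_simps)
  ultimately show ?thesis
    using key unfolding powr_products_squared[OF assms(1,2)] unfolding half by linarith
qed
section \<open>Adjoints and the Hilbert--Schmidt norm\<close>

lemma mat_adjoint_dim [simp]:
  "dim_row (mat_adjoint A) = dim_col A" "dim_col (mat_adjoint A) = dim_row A"
  by (auto simp: mat_adjoint_def)

lemma mat_adjoint_index [simp]:
  fixes A :: "complex mat"
  assumes "i < dim_col A" "j < dim_row A"
  shows "mat_adjoint A $$ (i, j) = cnj (A $$ (j, i))"
  using assms by (simp add: mat_adjoint_def mat_of_rows_index)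

lemma mat_adjoint_adjoint [simp]: "mat_adjoint (mat_adjoint A) = (A :: complex mat)"
  by (rule eq_matI) auto

lemma mat_adjoint_mult:
  fixes A B :: "complex mat"
  assumes "A \<in> carrier_mat n m" "B \<in> carrier_mat m k"
  shows "mat_adjoint (A * B) = mat_adjoint B * mat_adjoint A"
  by (rule eq_matI) (use assms in \<open>auto simp: scalar_prod_def mult.commute\<close>)

text \<open>The right-hand side is the trace of \<open>T\<^sup>* T\<close>, which visibly does not change when \<open>T\<close> is multiplied on
  the left by a unitary matrix.\<close>
lemma hs_norm_squared_trace:
  assumes T: "T \<in> carrier_mat n m"
  shows "(hs_norm T)\<^sup>2 = Re (\<Sum>j<m. (mat_adjoint T * T) $$ (j, j))"
proof -
  have "(hs_norm T)\<^sup>2 = (\<Sum>i<n. \<Sum>j<m. (cmod (T $$ (i, j)))\<^sup>2)"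
    using T by (simp add: hs_norm_def sum_nonneg)
  also have "\<dots> = (\<Sum>j<m. \<Sum>i<n. (cmod (T $$ (i, j)))\<^sup>2)"
    by (rule sum.swap)
  also have "\<dots> = Re (\<Sum>j<m. (mat_adjoint T * T) $$ (j, j))"
    using T
    by (auto simp: scalar_prod_def cmod_power2 lessThan_atLeast0 sum.distrib simp flip: power2_eq_square)
  finally show ?thesis .
qed

lemma hs_norm_adjoint: "hs_norm (mat_adjoint T) = hs_norm T"
  unfolding hs_norm_def by (subst sum.swap) simp

lemma hs_norm_unitary_left:
  assumes "unitary_mat n U" and T: "T \<in> carrier_mat n m"
  shows "hs_norm (U * T) = hs_norm T"
proof -
  have U: "U \<in> carrier_mat n n" "mat_adjoint U * U = 1\<^sub>m n"
    using assms by (auto simp: unitary_mat_def)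
  note c = U(1) mat_adjoint_carrier[OF U(1)] T mat_adjoint_carrier[OF T]
  have "mat_adjoint (U * T) * (U * T) = mat_adjoint T * (mat_adjoint U * (U * T))"
    using c by (simp add: mat_adjoint_mult[OF U(1) T] assoc_mult_mat[of _ m n _ n _ m])
  also have "mat_adjoint U * (U * T) = T"
    using c by (simp add: U(2) flip: assoc_mult_mat[of _ n n _ n _ m])
  finally have "(hs_norm (U * T))\<^sup>2 = (hs_norm T)\<^sup>2"
    using c by (simp add: hs_norm_squared_trace[of _ n m])
  moreover have "0 \<le> hs_norm S" for S by (simp add: hs_norm_def sum_nonneg)
  ultimately show ?thesis by (simp add: power2_eq_iff_nonneg)
qed

lemma hs_norm_unitary_conj:
  assumes U: "unitary_mat n U" and V: "unitary_mat n V" and T: "T \<in> carrier_mat n n"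
  shows "hs_norm (U * T * mat_adjoint V) = hs_norm T"
proof -
  have c: "U \<in> carrier_mat n n" "V \<in> carrier_mat n n" "mat_adjoint V \<in> carrier_mat n n"
    using U V by (auto simp: unitary_mat_def intro: mat_adjoint_carrier)
  have "hs_norm (T * mat_adjoint V) = hs_norm (V * mat_adjoint T)"
    using hs_norm_adjoint[of "T * mat_adjoint V"] c T by (simp add: mat_adjoint_mult)
  also have "\<dots> = hs_norm T"
    using hs_norm_unitary_left[OF V mat_adjoint_carrier[OF T]] by (simp add: hs_norm_adjoint)
  finally show ?thesis
    using hs_norm_unitary_left[OF U, of "T * mat_adjoint V" n] c T
    by (simp add: assoc_mult_mat[of _ n n _ n _ n])
qed

section \<open>Spectral theorem\<close>

lemma unitary_mat_mult:
  assumes "unitary_mat n U" "unitary_mat n V"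
  shows "unitary_mat n (U * V)"
proof -
  have c: "U \<in> carrier_mat n n" "V \<in> carrier_mat n n"
    "mat_adjoint U \<in> carrier_mat n n" "mat_adjoint V \<in> carrier_mat n n"
    and e: "mat_adjoint U * U = 1\<^sub>m n" "U * mat_adjoint U = 1\<^sub>m n"
    "mat_adjoint V * V = 1\<^sub>m n" "V * mat_adjoint V = 1\<^sub>m n"
    using assms by (auto simp: unitary_mat_def intro: mat_adjoint_carrier)
  have canc: "mat_adjoint U * (U * M) = M" "V * (mat_adjoint V * M) = M"
    if "M \<in> carrier_mat n n" for M
    using c e that by (simp_all flip: assoc_mult_mat)
  show ?thesis
    unfolding unitary_mat_def
    using c e by (simp add: mat_adjoint_mult[of _ n n _ n] assoc_mult_mat[of _ n n _ n _ n] canc)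
qed

lemma unitary_mat_of_orthonormal_cols:
  assumes "length us = n" "set us \<subseteq> carrier_vec n"
    and orth: "\<And>i j. i < n \<Longrightarrow> j < n \<Longrightarrow> us ! i \<bullet>c us ! j = (if i = j then 1 else 0)"
  shows "unitary_mat n (mat_of_cols n us)"
proof -
  let ?W = "mat_of_cols n us"
  have W: "?W \<in> carrier_mat n n" using assms by auto
  have cols: "us ! i \<in> carrier_vec n" if "i < n" for i
    using assms that by (meson nth_mem subsetD)
  have "mat_adjoint ?W * ?W = 1\<^sub>m n"
  proof (rule eq_matI)
    fix i j assume "i < dim_row (1\<^sub>m n :: complex mat)" "j < dim_col (1\<^sub>m n :: complex mat)"
    then have ij: "i < n" "j < n" by auto
    have "(mat_adjoint ?W * ?W) $$ (i, j) = us ! j \<bullet>c us ! i"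
      using ij W assms cols[OF ij(1)] cols[OF ij(2)]
      by (auto simp: scalar_prod_def mat_of_cols_index mult.commute intro!: sum.cong)
    then show "(mat_adjoint ?W * ?W) $$ (i, j) = 1\<^sub>m n $$ (i, j)"
      using ij orth[OF ij(2,1)] by simp
  qed (use assms in auto)
  moreover from this have "?W * mat_adjoint ?W = 1\<^sub>m n"
    using mat_mult_left_right_inverse[OF mat_adjoint_carrier[OF W] W] by simp
  ultimately show ?thesis using W by (simp add: unitary_mat_def)
qed

text \<open>Gram--Schmidt keeps the first vector of its input. Applied to a basis that starts with an
  eigenvector it yields an orthogonal, not yet normalised, basis that still starts with it.\<close>
lemma unitary_with_eigenvector_column:
  fixes A :: "complex mat"
  assumes A: "A \<in> carrier_mat n n" and n: "0 < n"
  obtains U e where "unitary_mat n U" "A *\<^sub>v col U 0 = e \<cdot>\<^sub>v col U 0"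
proof -
  obtain es where cp: "char_poly A = (\<Prod>e\<leftarrow>es. [:- e, 1:])" and "length es = n"
    using char_poly_factorized[OF A] by blast
  with n obtain e es' where es: "es = e # es'" by (cases es) auto
  have "eigenvalue A e"
    by (simp add: eigenvalue_root_char_poly[OF A] cp es)
  then obtain v where "eigenvector A v e" by (auto simp: eigenvalue_def)
  then have v: "v \<in> carrier_vec n" "v \<noteq> 0\<^sub>v n" and Av: "A *\<^sub>v v = e \<cdot>\<^sub>v v"
    using A by (auto simp: eigenvector_def)
  interpret cof_vec_space n "TYPE(complex)" .
  define b where "b = basis_completion v"
  define ws where "ws = gram_schmidt n b"
  note b = basis_completion[OF v, folded b_def]
  obtain vs where bv: "b = v # vs" using b(6,7) n by (cases b) auto
  note gs = gram_schmidt_result[OF b(2,4,5) refl, folded ws_def]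
  have ws0: "ws ! 0 = v"
    using gram_schmidt_hd[OF v(1), of vs] gs(4) b(6) n by (cases ws) (auto simp: ws_def bv)
  have len: "length ws = n" using gs(4) b(6) by simp
  have wsc: "ws ! i \<in> carrier_vec n" if "i < n" for i
    using gs(3) len that by (meson nth_mem subsetD)
  \<comment> \<open>The factor that gives the \<open>i\<close>-th vector of the orthogonal basis norm one.\<close>
  define c where "c i = complex_of_real (1 / sqrt (Re (ws ! i \<bullet>c ws ! i)))" for i
  define us where "us = map (\<lambda>i. c i \<cdot>\<^sub>v ws ! i) [0..<n]"
  have orth: "us ! i \<bullet>c us ! j = (if i = j then 1 else 0)" if ij: "i < n" "j < n" for i j
  proof -
    have prod: "us ! i \<bullet>c us ! j = c i * (cnj (c j) * (ws ! i \<bullet>c ws ! j))"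
      using ij wsc[OF ij(1)] wsc[OF ij(2)]
      by (simp add: us_def conjugate_smult_vec)
    show ?thesis
    proof (cases "i = j")
      case True
      define q where "q = ws ! i \<bullet>c ws ! i"
      have "q \<noteq> 0" using gs(2) ij len by (simp add: q_def corthogonalD)
      moreover have "0 \<le> q" unfolding q_def by (rule conjugate_square_ge_0_vec)
      ultimately have q: "q = complex_of_real (Re q)" "0 < Re q"
        by (auto simp: less_eq_complex_def complex_eq_iff)
      have "c i * (cnj (c i) * complex_of_real (Re q)) = 1"
        using q(2) by (simp add: c_def q_def[symmetric] flip: of_real_mult)
      then show ?thesis using prod True q(1) by (simp add: q_def)
    next
      case False
      then show ?thesis using prod corthogonalD[OF gs(2), of i j] ij len by simp
    qed
  qed
  have us: "length us = n" "set us \<subseteq> carrier_vec n"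
    using wsc by (auto simp: us_def)
  have "col (mat_of_cols n us) 0 = c 0 \<cdot>\<^sub>v v"
    using us n ws0 wsc[OF n] by (simp add: us_def)
  moreover have "A *\<^sub>v (c 0 \<cdot>\<^sub>v v) = e \<cdot>\<^sub>v (c 0 \<cdot>\<^sub>v v)"
    using A v Av by (simp add: mult_mat_vec smult_smult_assoc mult.commute)
  ultimately show thesis
    using that[OF unitary_mat_of_orthonormal_cols[OF us orth]] by metis
qed

lemma mat_adjoint_four_block_diag:
  fixes P Q :: "complex mat"
  assumes "P \<in> carrier_mat k k" "Q \<in> carrier_mat m m"
  shows "mat_adjoint (four_block_mat P (0\<^sub>m k m) (0\<^sub>m m k) Q)
    = four_block_mat (mat_adjoint P) (0\<^sub>m k m) (0\<^sub>m m k) (mat_adjoint Q)"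
  by (rule eq_matI) (use assms in auto)

lemma mult_four_block_diag:
  fixes P Q :: "complex mat"
  assumes "P \<in> carrier_mat k k" "Q \<in> carrier_mat m m" "P' \<in> carrier_mat k k" "Q' \<in> carrier_mat m m"
  shows "four_block_mat P (0\<^sub>m k m) (0\<^sub>m m k) Q * four_block_mat P' (0\<^sub>m k m) (0\<^sub>m m k) Q'
    = four_block_mat (P * P') (0\<^sub>m k m) (0\<^sub>m m k) (Q * Q')"
  using assms by (subst mult_four_block_mat[of _ k k _ m _ m]) auto

text \<open>In an orthonormal basis that starts with an eigenvector, the first column of the matrix is a
  multiple of the first unit vector; being Hermitian, the matrix has the same zeros in its first row
  and a real corner entry.\<close>
lemma unitary_reduction_step:
  assumes h: "hermitian_mat (Suc m) A"
  obtains W x C where "unitary_mat (Suc m) W" "hermitian_mat m C"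
    "A = W * four_block_mat (real_diag 1 (\<lambda>_. x)) (0\<^sub>m 1 m) (0\<^sub>m m 1) C * mat_adjoint W"
proof -
  let ?n = "Suc m"
  have A: "A \<in> carrier_mat ?n ?n" "mat_adjoint A = A" using h by (auto simp: hermitian_mat_def)
  obtain W e where W: "unitary_mat ?n W" and ev: "A *\<^sub>v col W 0 = e \<cdot>\<^sub>v col W 0"
    using unitary_with_eigenvector_column[OF A(1)] by blast
  have c: "W \<in> carrier_mat ?n ?n" "mat_adjoint W \<in> carrier_mat ?n ?n"
    and WW: "mat_adjoint W * W = 1\<^sub>m ?n" "W * mat_adjoint W = 1\<^sub>m ?n"
    using W by (auto simp: unitary_mat_def intro: mat_adjoint_carrier)
  note assoc = assoc_mult_mat[of _ ?n ?n _ ?n _ ?n]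
  have canc: "W * (mat_adjoint W * M) = M" if "M \<in> carrier_mat ?n ?n" for M
    using c WW that by (simp flip: assoc)
  define T where "T = mat_adjoint W * A * W"
  have T: "T \<in> carrier_mat ?n ?n" using A c by (simp add: T_def)
  have hT: "mat_adjoint T = T"
    using A c by (simp add: T_def mat_adjoint_mult[of _ ?n ?n _ ?n] assoc)
  have AT: "A = W * T * mat_adjoint W"
    using A c WW by (simp add: T_def assoc canc)
  have col0: "T $$ (i, 0) = (if i = 0 then e else 0)" if i: "i < ?n" for i
  proof -
    have "T $$ (i, 0) = row (mat_adjoint W) i \<bullet> col (A * W) 0"
      using A c i by (simp add: T_def assoc)
    also have "col (A * W) 0 = A *\<^sub>v col W 0" by (rule col_mult2[OF A(1) c(1)]) simp
    also have "row (mat_adjoint W) i \<bullet> (A *\<^sub>v col W 0) = e * (row (mat_adjoint W) i \<bullet> col W 0)"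
      unfolding ev using c i by (intro scalar_prod_smult_distrib[where n = ?n]) (auto intro!: carrier_vecI)
    also have "row (mat_adjoint W) i \<bullet> col W 0 = (mat_adjoint W * W) $$ (i, 0)"
      using c i by simp
    also have "\<dots> = (if i = 0 then 1 else 0)" using i by (simp add: WW)
    finally show ?thesis by simp
  qed
  have sym: "T $$ (i, j) = cnj (T $$ (j, i))" if "i < ?n" "j < ?n" for i j
    using mat_adjoint_index[of i T j] hT T that by simp
  have row0: "T $$ (0, j) = (if j = 0 then e else 0)" if j: "j < ?n" for j
    using sym[of 0 j] col0[OF j] sym[of 0 0] col0[of 0] j by auto
  have e: "e = complex_of_real (Re e)"
    using sym[of 0 0] col0[of 0] by (simp add: complex_eq_iff)
  define C where "C = mat m m (\<lambda>(i, j). T $$ (Suc i, Suc j))"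
  have "T = four_block_mat (real_diag 1 (\<lambda>_. Re e)) (0\<^sub>m 1 m) (0\<^sub>m m 1) C"
    by (rule eq_matI)
      (use T col0 row0 e in \<open>auto simp: real_diag_def mat_diag_def C_def less_Suc_eq_0_disj\<close>)
  moreover have "hermitian_mat m C"
    unfolding hermitian_mat_def
    by (intro conjI eq_matI) (auto simp: C_def sym[symmetric])
  ultimately show thesis using that W AT by metis
qed

theorem hermitian_spectral_decomposition:
  assumes "hermitian_mat n A"
  shows "\<exists>U d. spectral_decomposition n A U d"
  using assms
proof (induction n arbitrary: A)
  case 0
  then have "A = 1\<^sub>m 0 * real_diag 0 (\<lambda>_. 0) * mat_adjoint (1\<^sub>m 0)"
    by (intro eq_matI) (auto simp: hermitian_mat_def)
  moreover have "unitary_mat 0 (1\<^sub>m 0)" by (auto simp: unitary_mat_def intro: eq_matI)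
  ultimately show ?case unfolding spectral_decomposition_def by blast
next
  case (Suc m)
  let ?n = "Suc m"
  let ?B = "\<lambda>P Q. four_block_mat P (0\<^sub>m 1 m) (0\<^sub>m m 1) (Q :: complex mat)"
  obtain W x C where W: "unitary_mat ?n W" and C: "hermitian_mat m C"
    and A: "A = W * ?B (real_diag 1 (\<lambda>_. x)) C * mat_adjoint W"
    using unitary_reduction_step[OF Suc.prems] by blast
  obtain U d where "spectral_decomposition m C U d" using Suc.IH[OF C] by blast
  then have U: "unitary_mat m U" and CU: "C = U * real_diag m d * mat_adjoint U"
    by (auto simp: spectral_decomposition_def)
  have cU: "U \<in> carrier_mat m m" "mat_adjoint U \<in> carrier_mat m m"
    and UU: "mat_adjoint U * U = 1\<^sub>m m" "U * mat_adjoint U = 1\<^sub>m m"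
    using U by (auto simp: unitary_mat_def intro: mat_adjoint_carrier)
  let ?V = "?B (1\<^sub>m 1) U" and ?d = "case_nat x d"
  have adj1: "mat_adjoint (1\<^sub>m 1 :: complex mat) = 1\<^sub>m 1" by (rule eq_matI) auto
  have adjV: "mat_adjoint ?V = ?B (1\<^sub>m 1) (mat_adjoint U)"
    using cU by (simp only: mat_adjoint_four_block_diag[OF one_carrier_mat cU(1)] adj1)
  have cV: "?V \<in> carrier_mat ?n ?n" "mat_adjoint ?V \<in> carrier_mat ?n ?n"
    unfolding adjV using cU four_block_carrier_mat[of "1\<^sub>m 1" 1 1 _ m m] by auto
  have V: "unitary_mat ?n ?V"
    using cV cU UU four_block_one_mat[of 1 m] unfolding unitary_mat_def adjV
    by (simp add: mult_four_block_diag del: four_block_one_mat)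
  have diag: "real_diag ?n ?d = ?B (real_diag 1 (\<lambda>_. x)) (real_diag m d)"
    by (rule eq_matI) (auto simp: real_diag_def mat_diag_def less_Suc_eq_0_disj)
  have "?V * real_diag ?n ?d = ?B (1\<^sub>m 1 * real_diag 1 (\<lambda>_. x)) (U * real_diag m d)"
    unfolding diag by (rule mult_four_block_diag) (rule cU one_carrier_mat real_diag_carrier)+
  moreover have "?B (real_diag 1 (\<lambda>_. x)) (U * real_diag m d) * mat_adjoint ?V
      = ?B (real_diag 1 (\<lambda>_. x) * 1\<^sub>m 1) C"
    unfolding adjV CU
    by (rule mult_four_block_diag) (rule cU one_carrier_mat real_diag_carrier mult_carrier_mat)+
  ultimately have "?B (real_diag 1 (\<lambda>_. x)) C = ?V * real_diag ?n ?d * mat_adjoint ?V"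
    by (simp only: left_mult_one_mat[OF real_diag_carrier] right_mult_one_mat[OF real_diag_carrier])
  then have "A = W * (?V * real_diag ?n ?d * mat_adjoint ?V) * mat_adjoint W"
    using A by simp
  also have "\<dots> = (W * ?V) * real_diag ?n ?d * mat_adjoint (W * ?V)"
  proof -
    have cW: "W \<in> carrier_mat ?n ?n" "mat_adjoint W \<in> carrier_mat ?n ?n"
      using W by (auto simp: unitary_mat_def intro: mat_adjoint_carrier)
    show ?thesis
      unfolding mat_adjoint_mult[OF cW(1) cV(1)]
      using cW cV real_diag_carrier[of ?n ?d]
      by (simp add: assoc_mult_mat[of _ ?n ?n _ ?n _ ?n] del: four_block_carrier_mat)
  qed
  finally show ?case
    using unitary_mat_mult[OF W V] unfolding spectral_decomposition_def by blast
qed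

text \<open>The diagonal entry \<open>d\<^sub>i\<close> is the value of the quadratic form of \<open>A\<close> at the \<open>i\<close>-th column of \<open>U\<close>,
  which is a unit eigenvector.\<close>
lemma psd_spectral_decomposition:
  assumes "psd_mat n A"
  obtains U d where "spectral_decomposition n A U d" "\<And>i. i < n \<Longrightarrow> 0 \<le> d i"
proof -
  obtain U d where sd: "spectral_decomposition n A U d"
    using assms hermitian_spectral_decomposition unfolding psd_mat_def by blast
  then have c: "U \<in> carrier_mat n n" "mat_adjoint U \<in> carrier_mat n n"
    and UU: "mat_adjoint U * U = 1\<^sub>m n" and AU: "A = U * real_diag n d * mat_adjoint U"
    by (auto simp: spectral_decomposition_def unitary_mat_def intro: mat_adjoint_carrier)
  have "A * U = U * real_diag n d"
    using c UU real_diag_carrier[of n d] unfolding AU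
    by (simp add: assoc_mult_mat[of _ n n _ n _ n])
  have "0 \<le> d i" if i: "i < n" for i
  proof -
    have "A *\<^sub>v col U i = col (U * real_diag n d) i"
      using \<open>A * U = U * real_diag n d\<close> c i assms
      by (auto simp: psd_mat_def hermitian_mat_def simp flip: col_mult2)
    also have "\<dots> = complex_of_real (d i) \<cdot>\<^sub>v col U i"
      using c(1) i unfolding real_diag_def mat_diag_mult_right[OF c(1)]
      by (intro eq_vecI) (simp_all add: mult.commute)
    finally have "(A *\<^sub>v col U i) \<bullet>c col U i = complex_of_real (d i) * (col U i \<bullet>c col U i)"
      using c i by simp
    also have "col U i \<bullet>c col U i = (mat_adjoint U * U) $$ (i, i)"
      using c i by (auto simp: scalar_prod_def mult.commute intro!: sum.cong)
    also have "\<dots> = 1" using i by (simp add: UU)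
    finally have "Re ((A *\<^sub>v col U i) \<bullet>c col U i) = d i" by simp
    moreover have "col U i \<in> carrier_vec n"
      using carrier_matD(1)[OF c(1)] by (intro carrier_vecI) simp
    ultimately show ?thesis using assms unfolding psd_mat_def by fastforce
  qed
  with sd that show thesis by blast
qed

section \<open>Functions of the commuting pair of left and right multiplication\<close>

text \<open>This is \<open>g(L, R) X\<close> in the joint functional calculus of the commuting operators \<open>L\<close>, left
  multiplication by \<open>U diag(d) U\<^sup>*\<close>, and \<open>R\<close>, right multiplication by \<open>V diag(e) V\<^sup>*\<close>: the matrices
  \<open>u\<^sub>i v\<^sub>j\<^sup>*\<close> built from the columns of \<open>U\<close> and \<open>V\<close> are joint eigenvectors with eigenvalues
  \<open>(d\<^sub>i, e\<^sub>j)\<close>, and the entries of \<open>U\<^sup>* X V\<close> are the coordinates of \<open>X\<close> in this basis.\<close>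
definition joint_fun ::
  "nat \<Rightarrow> complex mat \<Rightarrow> (nat \<Rightarrow> real) \<Rightarrow> complex mat \<Rightarrow> (nat \<Rightarrow> real) \<Rightarrow> complex mat
    \<Rightarrow> (real \<Rightarrow> real \<Rightarrow> real) \<Rightarrow> complex mat" where
  "joint_fun n U d V e X g = U * mat n n (\<lambda>(i, j).
     complex_of_real (g (d i) (e j)) * (mat_adjoint U * X * V) $$ (i, j)) * mat_adjoint V"

lemma joint_fun_product:
  assumes U: "unitary_mat n U" and V: "unitary_mat n V" and X: "X \<in> carrier_mat n n"
  shows "U * real_diag n (p \<circ> d) * mat_adjoint U * X * (V * real_diag n (q \<circ> e) * mat_adjoint V)
    = joint_fun n U d V e X (\<lambda>x y. p x * q y)"
proof -
  have c: "U \<in> carrier_mat n n" "V \<in> carrier_mat n n"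
    "mat_adjoint U \<in> carrier_mat n n" "mat_adjoint V \<in> carrier_mat n n"
    using U V by (auto simp: unitary_mat_def intro: mat_adjoint_carrier)
  let ?Y = "mat_adjoint U * X * V"
  have Y: "?Y \<in> carrier_mat n n" using c X by simp
  have "U * real_diag n (p \<circ> d) * mat_adjoint U * X * (V * real_diag n (q \<circ> e) * mat_adjoint V)
      = U * (real_diag n (p \<circ> d) * ?Y * real_diag n (q \<circ> e)) * mat_adjoint V"
    using c X real_diag_carrier[of n]
    by (simp add: assoc_mult_mat[of _ n n _ n _ n] mult_carrier_mat[where n = n])
  also have "real_diag n (p \<circ> d) * ?Y * real_diag n (q \<circ> e)
      = mat n n (\<lambda>(i, j). complex_of_real (p (d i) * q (e j)) * ?Y $$ (i, j))"
    unfolding real_diag_def mat_diag_mult_left[OF Y]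
    by (subst mat_diag_mult_right[of _ n]) (auto intro!: eq_matI)
  finally show ?thesis unfolding joint_fun_def .
qed

lemma joint_fun_smult:
  assumes "unitary_mat n U" "unitary_mat n V"
  shows "complex_of_real c \<cdot>\<^sub>m joint_fun n U d V e X g = joint_fun n U d V e X (\<lambda>x y. c * g x y)"
proof -
  have c: "U \<in> carrier_mat n n" "mat_adjoint V \<in> carrier_mat n n"
    using assms by (auto simp: unitary_mat_def intro: mat_adjoint_carrier)
  let ?M = "\<lambda>g. mat n n (\<lambda>(i, j). complex_of_real (g (d i) (e j)) * (mat_adjoint U * X * V) $$ (i, j))"
  have "?M (\<lambda>x y. c * g x y) = complex_of_real c \<cdot>\<^sub>m ?M g" by (rule eq_matI) auto
  then show ?thesis
    unfolding joint_fun_def using c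
    by (simp add: mult_smult_distrib[of _ n n _ n] mult_smult_assoc_mat[of _ n n _ n])
qed

lemma joint_fun_add:
  assumes "unitary_mat n U" "unitary_mat n V"
  shows "joint_fun n U d V e X g + joint_fun n U d V e X h
    = joint_fun n U d V e X (\<lambda>x y. g x y + h x y)"
proof -
  have c: "U \<in> carrier_mat n n" "mat_adjoint V \<in> carrier_mat n n"
    using assms by (auto simp: unitary_mat_def intro: mat_adjoint_carrier)
  let ?M = "\<lambda>g. mat n n (\<lambda>(i, j). complex_of_real (g (d i) (e j)) * (mat_adjoint U * X * V) $$ (i, j))"
  have "?M (\<lambda>x y. g x y + h x y) = ?M g + ?M h" by (rule eq_matI) (auto simp: algebra_simps)
  then show ?thesis
    unfolding joint_fun_def using c
    by (simp add: mult_add_distrib_mat[of _ n n _ n] add_mult_distrib_mat[of _ n n _ _ n])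
qed

text \<open>The integral of \<open>h\<close> against the measure with mass \<open>w\<^sub>i\<^sub>j\<close> at the point \<open>(d\<^sub>i, e\<^sub>j)\<close>. Written this
  way, a linear combination of squared norms is again a single integral, and an inequality between
  such combinations follows from a pointwise one.\<close>
definition spectral_sum ::
  "nat \<Rightarrow> (nat \<Rightarrow> real) \<Rightarrow> (nat \<Rightarrow> real) \<Rightarrow> (nat \<Rightarrow> nat \<Rightarrow> real) \<Rightarrow> (real \<Rightarrow> real \<Rightarrow> real) \<Rightarrow> real" where
  "spectral_sum n d e w h = (\<Sum>i<n. \<Sum>j<n. h (d i) (e j) * w i j)"

lemma hs_norm_joint_fun:
  assumes "unitary_mat n U" "unitary_mat n V"
  shows "(hs_norm (joint_fun n U d V e X g))\<^sup>2
    = spectral_sum n d e (\<lambda>i j. (cmod ((mat_adjoint U * X * V) $$ (i, j)))\<^sup>2) (\<lambda>x y. (g x y)\<^sup>2)"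
  unfolding joint_fun_def spectral_sum_def
  by (subst hs_norm_unitary_conj[OF assms])
    (auto simp: hs_norm_def sum_nonneg norm_mult power_mult_distrib)

lemma spectral_sum_linear:
  "c * spectral_sum n d e w g = spectral_sum n d e w (\<lambda>x y. c * g x y)"
  "spectral_sum n d e w g + spectral_sum n d e w h = spectral_sum n d e w (\<lambda>x y. g x y + h x y)"
  "spectral_sum n d e w g - spectral_sum n d e w h = spectral_sum n d e w (\<lambda>x y. g x y - h x y)"
  by (simp_all only: spectral_sum_def sum_distrib_left sum.distrib sum_subtractf mult.assoc
      distrib_right left_diff_distrib)

lemma spectral_sum_mono:
  assumes "\<And>i. i < n \<Longrightarrow> 0 \<le> d i" "\<And>j. j < n \<Longrightarrow> 0 \<le> e j" "\<And>i j. 0 \<le> w i j"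
    and "\<And>x y. 0 \<le> x \<Longrightarrow> 0 \<le> y \<Longrightarrow> g x y \<le> h x y"
  shows "spectral_sum n d e w g \<le> spectral_sum n d e w h"
  unfolding spectral_sum_def using assms by (intro sum_mono mult_right_mono) auto

theorem proposition3p8:
  fixes n :: nat and A B X :: "complex mat" and \<nu> r R r\<^sub>0 :: real
  assumes "psd_mat n A" and "psd_mat n B" and "X \<in> carrier_mat n n"
    and "r = min \<nu> (1 - \<nu>)" and "R = max \<nu> (1 - \<nu>)" and "r\<^sub>0 = min (2 * r) (1 - 2 * r)"
  shows
    "(0 < \<nu> \<and> \<nu> \<le> 1/2 \<longrightarrow>
        r\<^sup>2 * (hs_norm (A * X + X * B))\<^sup>2
          - (4 * (r\<^sup>2 * (hs_norm (A powr\<^sub>m (1/2) * X * B powr\<^sub>m (1/2)))\<^sup>2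
                  + r\<^sub>0 * (hs_norm (A powr\<^sub>m (3/4) * X * B powr\<^sub>m (1/4)))\<^sup>2)
             - r\<^sub>0 * (hs_norm (A powr\<^sub>m (1/2) * X * B powr\<^sub>m (1/2) + A * X))\<^sup>2)
        \<le> (hs_norm (complex_of_real (1 - \<nu>) \<cdot>\<^sub>m (A * X) + complex_of_real \<nu> \<cdot>\<^sub>m (X * B)))\<^sup>2
          - (hs_norm (A powr\<^sub>m (1 - \<nu>) * X * B powr\<^sub>m \<nu>))\<^sup>2
      \<and> (hs_norm (complex_of_real (1 - \<nu>) \<cdot>\<^sub>m (A * X) + complex_of_real \<nu> \<cdot>\<^sub>m (X * B)))\<^sup>2
          - (hs_norm (A powr\<^sub>m (1 - \<nu>) * X * B powr\<^sub>m \<nu>))\<^sup>2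
        \<le> R\<^sup>2 * (hs_norm (A * X + X * B))\<^sup>2
          - (4 * (R\<^sup>2 * (hs_norm (A powr\<^sub>m (1/2) * X * B powr\<^sub>m (1/2)))\<^sup>2
                  + r\<^sub>0 * (hs_norm (A powr\<^sub>m (1/4) * X * B powr\<^sub>m (3/4)))\<^sup>2)
             - r\<^sub>0 * (hs_norm (A powr\<^sub>m (1/2) * X * B powr\<^sub>m (1/2) + X * B))\<^sup>2))
     \<and>
     (1/2 < \<nu> \<and> \<nu> < 1 \<longrightarrow>
        r\<^sup>2 * (hs_norm (A * X + X * B))\<^sup>2
          - (4 * (r\<^sup>2 * (hs_norm (A powr\<^sub>m (1/2) * X * B powr\<^sub>m (1/2)))\<^sup>2
                  + r\<^sub>0 * (hs_norm (A powr\<^sub>m (1/4) * X * B powr\<^sub>m (3/4)))\<^sup>2)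
             - r\<^sub>0 * (hs_norm (A powr\<^sub>m (1/2) * X * B powr\<^sub>m (1/2) + X * B))\<^sup>2)
        \<le> (hs_norm (complex_of_real (1 - \<nu>) \<cdot>\<^sub>m (A * X) + complex_of_real \<nu> \<cdot>\<^sub>m (X * B)))\<^sup>2
          - (hs_norm (A powr\<^sub>m (1 - \<nu>) * X * B powr\<^sub>m \<nu>))\<^sup>2
      \<and> (hs_norm (complex_of_real (1 - \<nu>) \<cdot>\<^sub>m (A * X) + complex_of_real \<nu> \<cdot>\<^sub>m (X * B)))\<^sup>2
          - (hs_norm (A powr\<^sub>m (1 - \<nu>) * X * B powr\<^sub>m \<nu>))\<^sup>2
        \<le> R\<^sup>2 * (hs_norm (A * X + X * B))\<^sup>2
          - (4 * (R\<^sup>2 * (hs_norm (A powr\<^sub>m (1/2) * X * B powr\<^sub>m (1/2)))\<^sup>2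
                  + r\<^sub>0 * (hs_norm (A powr\<^sub>m (3/4) * X * B powr\<^sub>m (1/4)))\<^sup>2)
             - r\<^sub>0 * (hs_norm (A powr\<^sub>m (1/2) * X * B powr\<^sub>m (1/2) + A * X))\<^sup>2))"
proof -
  obtain U d where A: "spectral_decomposition n A U d" and d: "\<And>i. i < n \<Longrightarrow> 0 \<le> d i"
    using psd_spectral_decomposition[OF assms(1)] by blast
  obtain V e where B: "spectral_decomposition n B V e" and e: "\<And>i. i < n \<Longrightarrow> 0 \<le> e i"
    using psd_spectral_decomposition[OF assms(2)] by blast
  note X = assms(3)
  have U: "unitary_mat n U" and V: "unitary_mat n V"
    using A B by (auto simp: spectral_decomposition_def)
  let ?J = "joint_fun n U d V e X"
  let ?w = "\<lambda>i j. (cmod ((mat_adjoint U * X * V) $$ (i, j)))\<^sup>2"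
  let ?L = "spectral_sum n d e ?w"
  \<comment> \<open>To treat \<open>AX\<close> and \<open>XB\<close> as products \<open>p(A) X q(B)\<close>, take the constant function 1 for the
    missing factor; the power with exponent 0 would give the range projection instead.\<close>
  have one: "W * real_diag n ((\<lambda>_. 1) \<circ> (f :: nat \<Rightarrow> real)) * mat_adjoint W = 1\<^sub>m n"
    if "unitary_mat n W" for W f
    using that right_mult_one_mat[of W n n] by (auto simp: unitary_mat_def real_diag_def comp_def)
  have carr: "A \<in> carrier_mat n n" "B \<in> carrier_mat n n"
    using assms(1,2) by (auto simp: psd_mat_def hermitian_mat_def)
  have AX: "A * X = ?J (\<lambda>x y. x)"
    using joint_fun_product[OF U V X, of "\<lambda>x. x" d "\<lambda>_. 1" e] A carr X
    unfolding one[OF V] by (simp add: spectral_decomposition_def comp_def)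
  have XB: "X * B = ?J (\<lambda>x y. y)"
    using joint_fun_product[OF U V X, of "\<lambda>_. 1" d "\<lambda>y. y" e] B carr X
    unfolding one[OF U] by (simp add: spectral_decomposition_def comp_def)
  have pw: "A powr\<^sub>m p * X * B powr\<^sub>m q = ?J (\<lambda>x y. x powr p * y powr q)" for p q
    unfolding mat_powr_def spectral_fun_eq[OF A] spectral_fun_eq[OF B]
    by (rule joint_fun_product[OF U V X])
  note to_sum = AX XB pw joint_fun_smult[OF U V] joint_fun_add[OF U V] hs_norm_joint_fun[OF U V]
    spectral_sum_linear
  have mono: "?L g \<le> ?L h" if "\<And>x y. 0 \<le> x \<Longrightarrow> 0 \<le> y \<Longrightarrow> g x y \<le> h x y" for g h
    using that d e by (intro spectral_sum_mono) auto
  show ?thesis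
  proof (intro conjI impI, goal_cases)
    case 1
    then have r: "r = \<nu>" "r\<^sub>0 = min (2 * \<nu>) (1 - 2 * \<nu>)"
      using assms by auto
    show ?case
      unfolding to_sum r(1)
      by (rule mono, rule scalar_lower_bound) (use 1 r(2) in auto)
  next
    case 2
    then have r: "R = 1 - \<nu>" "0 \<le> r\<^sub>0"
      using assms by auto
    show ?case
      unfolding to_sum r(1)
      by (rule mono, rule scalar_upper_bound) (use 2 r(2) in auto)
  next
    case 3
    then have r: "r = 1 - \<nu>" "r\<^sub>0 = min (2 * (1 - \<nu>)) (1 - 2 * (1 - \<nu>))"
      using assms by auto
    show ?case
      unfolding to_sum r(1)
    proof (rule mono, goal_cases)
      case (1 x y)
      \<comment> \<open>Exchanging the two numbers turns the weight \<open>\<nu>\<close> into \<open>1 - \<nu>\<close>.\<close>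
      show ?case
        using scalar_lower_bound[OF 1(2,1) _ _ r(2)] 3 by (simp add: ac_simps)
    qed
  next
    case 4
    then have r: "R = \<nu>" "0 \<le> r\<^sub>0"
      using assms by auto
    show ?case
      unfolding to_sum r(1)
    proof (rule mono, goal_cases)
      case (1 x y)
      show ?case
        using scalar_upper_bound[OF 1(2,1) _ r(2), of "1 - \<nu>"] 4 by (simp add: ac_simps)
    qed
  qed
qed

end
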